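(* Let $y$ be uniform on $\{1,\dots,K\}$. For each $k$ let $q(z_c,z_s\mid y=k)$ be a joint probability distribution of $(z_c,z_s)$, let $p(z_c\mid y=k)$ be a probability distribution for $z_c$, and let $p(z_s)=\mathcal N(0,I)$. Define $M_{\mathrm{fact}} := \mathbb E_y[\mathrm{KL}(q(z_c,z_s\mid y)\,\|\,p(z_c\mid y)\,p(z_s))]$. Then $$q(z_c,z_s\mid y=k)=p(z_c\mid y=k)\,p(z_s)\quad\text{for a.e. } k$$ if and only if $M_{\mathrm{fact}}=0$, i.e. if and only if the following four quantities all vanish: (1) $\mathrm{KL}(q(z_s)\,\|\,p(z_s))$; (2) $I_q(z_s;y)$; (3) $\mathbb E_y[\mathrm{KL}(q(z_c\mid y)\,\|\,p(z_c\mid y))]$; (4) $I_q(z_c;z_s\mid y)$. In particular, class-invariant style, $I_q(z_s;y)=0$, is necessary for this equality but is not sufficient: it must be accompanied by a matched style prior (vanishing of (1)), a matched semantic prior (vanishing of (3)), and within-class independence of $z_c$ and $z_s$ (vanishing of (4)).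
   Context: Here $K\ge 1$ is an integer; $z_c$ (the semantic variable) takes values in a measurable space and $z_s$ (the style variable) takes values in $\mathbb R^{d_s}$. $q(z_c,z_s\mid y=k)$ is the encoder's joint class-conditional distribution; $q(z_c\mid y=k)$ and $q(z_s\mid y=k)$ are its marginals, and $q(z_s)=\mathbb E_y[q(z_s\mid y)]=\frac1K\sum_{k=1}^K q(z_s\mid y=k)$ is the aggregated style distribution. $p(z_c\mid y)\,p(z_s)$ denotes the product measure (the law of independently drawn $z_c\sim p(z_c\mid y)$ and $z_s\sim p(z_s)$). $\mathbb E_y$ is expectation over the uniform label $y$, and "a.e. $k$" is with respect to the law of $y$. $\mathrm{KL}$ is the Kullback–Leibler divergence, with values in $[0,\infty]$. $I_q(z_s;y)$ is the mutual information of $z_s$ and $y$ under the joint law in which $y$ is uniform and $z_s\mid y\sim q(z_s\mid y)$. $I_q(z_c;z_s\mid y)=\mathbb E_y[I_q(z_c;z_s\mid y=k)]$ is the conditional mutual information, where $I_q(z_c;z_s\mid y=k)=\mathrm{KL}(q(z_c,z_s\mid y=k)\,\|\,q(z_c\mid y=k)\,q(z_s\mid y=k))$. "Not sufficient" means that there are choices of the joint class-conditional distributions $q(z_c,z_s\mid y=k)$ and the semantic priors $p(z_c\mid y=k)$, $k=1,\dots,K$ (with $p(z_s)=\mathcal N(0,I)$), for which $I_q(z_s;y)=0$ but the equality $q(z_c,z_s\mid y=k)=p(z_c\mid y=k)\,p(z_s)$ for a.e. $k$ fails. *)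

theory Defs
  imports "HOL-Probability.Probability"
begin

text \<open>
  Extended-valued Kullback-Leibler divergence \<open>KL(P || Q)\<close> in nats.  The library's real-valued
  \<^const>\<open>KL_divergence\<close> takes the reference measure \<open>Q\<close> first and is meaningful only when
  \<open>P << Q\<close> and \<open>ln (dP/dQ)\<close> is \<open>P\<close>-integrable.  For probability measures \<open>P << Q\<close> the negative part
  of \<open>ln (dP/dQ)\<close> always has finite \<open>P\<close>-integral, so failure of integrability means that the
  divergence is infinite.  The coercion \<open>ennreal\<close> does not truncate: see \<open>KL_divergence_nonneg\<close>.
\<close>

definition KL :: "'a measure \<Rightarrow> 'a measure \<Rightarrow> ennreal" where
  "KL P Q =
    (if absolutely_continuous Q P \<and> integrable P (entropy_density (exp 1) Q P)
     then ennreal (KL_divergence (exp 1) Q P)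
     else \<infinity>)"

lemma KL_divergence_nonneg:
  assumes "prob_space P" "prob_space Q" "sets P = sets Q" "absolutely_continuous Q P"
    and int: "integrable P (entropy_density (exp 1) Q P)"
  shows "0 \<le> KL_divergence (exp 1) Q P"
proof -
  interpret P: prob_space P by fact
  interpret Q: prob_space Q by fact
  interpret Q: information_space Q "exp 1" by unfold_locales simp
  define D where "D = (\<lambda>x. enn2real (RN_deriv Q P x))"
  have P: "density Q (RN_deriv Q P) = P"
    using assms by (intro Q.density_RN_deriv) auto
  have "AE x in Q. RN_deriv Q P x \<noteq> \<infinity>"
    using assms P.sigma_finite_measure_axioms by (intro Q.RN_deriv_finite) auto
  then have "density Q (\<lambda>x. ennreal (D x)) = density Q (RN_deriv Q P)"
    unfolding D_def by (intro density_cong) (auto elim!: eventually_mono simp: less_top)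
  with P have D: "density Q (\<lambda>x. ennreal (D x)) = P" by simp
  have D_meas: "D \<in> borel_measurable Q" and D_nn: "\<And>x. 0 \<le> D x" unfolding D_def by auto
  have "integrable (density Q (\<lambda>x. ennreal (D x))) (\<lambda>x. log (exp 1) (D x))"
    using int unfolding D by (simp add: entropy_density_def D_def comp_def)
  then have "integrable Q (\<lambda>x. D x * log (exp 1) (D x))"
    using D_meas D_nn by (subst (asm) integrable_density) auto
  then have "P \<noteq> Q \<Longrightarrow> 0 < KL_divergence (exp 1) Q P"
    using Q.KL_gt_0[of D] D D_meas D_nn P.prob_space_axioms by simp
  then show ?thesis
    using Q.KL_same_eq_0[of "exp 1"] by fastforce
qed

definition mutual_info :: "'a measure \<Rightarrow> 'b measure \<Rightarrow> ('a \<times> 'b) measure \<Rightarrow> ennreal" where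
  "mutual_info S T J = KL J (distr J S fst \<Otimes>\<^sub>M distr J T snd)"

definition std_gaussian :: "(real ^ 'd) measure" where
  "std_gaussian =
    density lborel (\<lambda>x. ennreal (exp (- (norm x)\<^sup>2 / 2) / sqrt (2 * pi) ^ CARD('d)))"

definition label_law :: "nat \<Rightarrow> nat measure" where
  "label_law K = uniform_count_measure {1..K}"

text \<open>
  In what follows \<open>C\<close> is the measurable space of the semantic variable \<open>z_c\<close> (only its space and
  \<open>\<sigma>\<close>-algebra matter), \<open>q k\<close> is the joint law \<open>q(z_c, z_s | y = k)\<close> on \<open>C \<Otimes>\<^sub>M borel\<close> and \<open>p k\<close> is
  \<open>p(z_c | y = k)\<close>.
\<close>

definition style :: "(nat \<Rightarrow> ('c \<times> (real ^ 'd)) measure) \<Rightarrow> nat \<Rightarrow> (real ^ 'd) measure" where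
  "style q k = distr (q k) borel snd"

definition semantic :: "'c measure \<Rightarrow> (nat \<Rightarrow> ('c \<times> (real ^ 'd)) measure) \<Rightarrow> nat \<Rightarrow> 'c measure" where
  "semantic C q k = distr (q k) C fst"

definition agg_style :: "nat \<Rightarrow> (nat \<Rightarrow> ('c \<times> (real ^ 'd)) measure) \<Rightarrow> (real ^ 'd) measure" where
  "agg_style K q = label_law K \<bind> style q"

text \<open>The joint law of \<open>(z_s, y)\<close> with \<open>y\<close> uniform and \<open>z_s | y = k\<close> distributed as \<open>q(z_s | y = k)\<close>.\<close>

definition style_label_law ::
  "nat \<Rightarrow> (nat \<Rightarrow> ('c \<times> (real ^ 'd)) measure) \<Rightarrow> ((real ^ 'd) \<times> nat) measure" where
  "style_label_law K q =
    label_law K \<bind> (\<lambda>k. distr (style q k) (borel \<Otimes>\<^sub>M count_space {1..K}) (\<lambda>s. (s, k)))"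

definition style_label_info :: "nat \<Rightarrow> (nat \<Rightarrow> ('c \<times> (real ^ 'd)) measure) \<Rightarrow> ennreal" where
  "style_label_info K q = mutual_info borel (count_space {1..K}) (style_label_law K q)"

definition cond_info :: "nat \<Rightarrow> 'c measure \<Rightarrow> (nat \<Rightarrow> ('c \<times> (real ^ 'd)) measure) \<Rightarrow> ennreal" where
  "cond_info K C q = (\<integral>\<^sup>+k. mutual_info C borel (q k) \<partial>label_law K)"

definition M_fact ::
  "nat \<Rightarrow> (nat \<Rightarrow> ('c \<times> (real ^ 'd)) measure) \<Rightarrow> (nat \<Rightarrow> 'c measure) \<Rightarrow> ennreal" where
  "M_fact K q p = (\<integral>\<^sup>+k. KL (q k) (p k \<Otimes>\<^sub>M std_gaussian) \<partial>label_law K)"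

lemma expectation_label_law:
  "(\<integral>\<^sup>+k. f k \<partial>label_law K) = (\<Sum>k=1..K. f k) / of_nat K"
proof (cases "K = 0")
  case False
  have "(\<integral>\<^sup>+k. f k \<partial>label_law K) = (\<Sum>k=1..K. ennreal (1 / real K) * f k)"
    by (simp add: label_law_def uniform_count_measure_def nn_integral_point_measure_finite)
  also have "\<dots> = (\<Sum>k=1..K. f k) * ennreal (1 / real K)"
    by (simp add: sum_distrib_left mult.commute)
  also have "ennreal (1 / real K) = inverse (of_nat K)"
    using False by (simp add: inverse_eq_divide[symmetric] ennreal_of_nat_eq_real_of_nat inverse_ennreal)
  finally show ?thesis by (simp add: divide_ennreal_def)
qed (simp add: label_law_def uniform_count_measure_def nn_integral_point_measure_finite)

lemma emeasure_agg_style: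
  assumes K: "1 \<le> K" and q: "q \<in> {1..K} \<rightarrow> space (prob_algebra (C \<Otimes>\<^sub>M borel))"
    and A: "A \<in> sets borel"
  shows "emeasure (agg_style K q) A = (\<Sum>k=1..K. emeasure (style q k) A) / of_nat K"
proof -
  have "style q k \<in> space (subprob_algebra borel)" if "k \<in> {1..K}" for k
  proof -
    have qk: "prob_space (q k)" "sets (q k) = sets (C \<Otimes>\<^sub>M borel)"
      using q that by (auto simp: space_prob_algebra)
    have "snd \<in> q k \<rightarrow>\<^sub>M borel"
      using qk(2) by (simp cong: measurable_cong_sets)
    then have "prob_space (style q k)"
      unfolding style_def using qk(1) by (intro prob_space.prob_space_distr) auto
    then show ?thesis
      by (simp add: space_subprob_algebra style_def prob_space_imp_subprob_space)
  qed
  then have "style q \<in> label_law K \<rightarrow>\<^sub>M subprob_algebra borel"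
    by (auto simp: label_law_def measurable_def space_uniform_count_measure sets_uniform_count_measure)
  moreover have "space (label_law K) \<noteq> {}"
    using K by (simp add: label_law_def space_uniform_count_measure)
  ultimately show ?thesis
    unfolding agg_style_def using A
    by (simp add: emeasure_bind expectation_label_law)
qed

lemma std_gaussian_density_prod:
  fixes x :: "real ^ 'd"
  shows "exp (- (norm x)\<^sup>2 / 2) / sqrt (2 * pi) ^ CARD('d) = (\<Prod>b\<in>Basis. std_normal_density (x \<bullet> b))"
proof -
  have "(norm x)\<^sup>2 = (\<Sum>b\<in>Basis. (x \<bullet> b)\<^sup>2)"
    by (subst power2_norm_eq_inner, subst euclidean_inner) (simp add: power2_eq_square)
  then have "exp (- (norm x)\<^sup>2 / 2) = (\<Prod>b\<in>Basis. exp (- (x \<bullet> b)\<^sup>2 / 2))"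
    by (simp add: exp_sum[symmetric] sum_negf sum_divide_distrib)
  then show ?thesis
    by (simp add: std_normal_density_def prod_dividef power_one_over field_simps)
qed

lemma prob_space_std_gaussian: "prob_space (std_gaussian :: (real ^ 'd) measure)"
proof
  have 1: "(\<integral>\<^sup>+x. ennreal (std_normal_density x) \<partial>lborel) = 1"
    using prob_space.emeasure_space_1[OF prob_space_normal_density[of 1 0]]
    by (simp add: emeasure_density)
  have "emeasure (std_gaussian :: (real ^ 'd) measure) (space std_gaussian)
      = (\<integral>\<^sup>+x. (\<Prod>b\<in>Basis. ennreal (std_normal_density ((x :: real ^ 'd) \<bullet> b))) \<partial>lborel)"
    unfolding std_gaussian_def std_gaussian_density_prod
    by (simp add: emeasure_density prod_ennreal)
  also have "\<dots> = (\<Prod>b\<in>(Basis :: (real^'d) set). \<integral>\<^sup>+x. ennreal (std_normal_density x) \<partial>lborel)"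
    by (rule nn_integral_lborel_prod) auto
  finally show "emeasure (std_gaussian :: (real ^ 'd) measure) (space std_gaussian) = 1"
    by (simp add: 1)
qed

end

theory Submission
  imports Defs
begin

text \<open>
  A Kullback-Leibler divergence of probability measures vanishes exactly when the two measures
  agree, so each of the quantities vanishes exactly when a certain identity of measures holds.
  Those identities say that every \<open>q k\<close> is the product of its marginals, that the first marginal
  is \<open>p k\<close>, and that the second marginal does not depend on \<open>k\<close> and its average is Gaussian.
  Together they say that \<open>q k\<close> is \<open>p k\<close> times the Gaussian.  For the failure of sufficiency, replace
  the Gaussian style by a point mass that is the same in every class.
\<close>

section \<open>Vanishing of the Kullback-Leibler divergence\<close>

lemma KL_eq_0_iff:
  assumes "prob_space P" "prob_space Q" "sets P = sets Q"
  shows "KL P Q = 0 \<longleftrightarrow> P = Q"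
proof -
  interpret Q: prob_space Q by fact
  interpret Q: information_space Q "exp 1" by unfold_locales simp
  have self: "absolutely_continuous Q Q \<and> integrable Q (entropy_density (exp 1) Q Q)"
  proof
    show "absolutely_continuous Q Q"
      by (simp add: absolutely_continuous_def)
    \<comment> \<open>The constant 1 is a density of \<open>Q\<close> with respect to itself, so by
      uniqueness it is the derivative a.e.; its logarithm is 0, which is integrable.\<close>
    have "AE x in Q. 1 = RN_deriv Q Q x"
      by (rule Q.RN_deriv_unique) (auto simp: density_1)
    then have "AE x in Q. entropy_density (exp 1) Q Q x = 0"
      by (elim AE_mp) (simp add: entropy_density_def)
    then show "integrable Q (entropy_density (exp 1) Q Q)"
      by (subst integrable_cong_AE[where g = "\<lambda>_. 0"])
         (auto intro: measurable_entropy_density)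
  qed
  show ?thesis
  proof (cases "absolutely_continuous Q P \<and> integrable P (entropy_density (exp 1) Q P)")
    case True
    \<comment> \<open>\<open>ennreal\<close> sends negative reals to 0 as well, so nonnegativity of
      the real divergence is what keeps a zero of \<open>KL\<close> from hiding a negative
      value.\<close>
    then have "KL P Q = 0 \<longleftrightarrow> KL_divergence (exp 1) Q P = 0"
      using KL_divergence_nonneg[OF assms] by (auto simp: KL_def ennreal_eq_0_iff)
    also have "\<dots> \<longleftrightarrow> P = Q"
      using True assms by (intro Q.KL_eq_0_iff_eq_ac) auto
    finally show ?thesis .
  next
    \<comment> \<open>Here \<open>KL P Q\<close> is infinite, and \<open>P = Q\<close> is excluded
      because \<open>self\<close> would put the pair into the first case.\<close>
    case False
    then show ?thesis
      using self by (auto simp: KL_def)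
  qed
qed

section \<open>Marginals of joint laws and vanishing mutual information\<close>

lemma prob_space_distr_fst:
  assumes "prob_space J" "sets J = sets (S \<Otimes>\<^sub>M T)"
  shows "prob_space (distr J S fst)"
  using assms by (intro prob_space.prob_space_distr) (simp_all cong: measurable_cong_sets)

lemma prob_space_distr_snd:
  assumes "prob_space J" "sets J = sets (S \<Otimes>\<^sub>M T)"
  shows "prob_space (distr J T snd)"
  using assms by (intro prob_space.prob_space_distr) (simp_all cong: measurable_cong_sets)

lemma mutual_info_eq_0_iff:
  assumes "prob_space J" "sets J = sets (S \<Otimes>\<^sub>M T)"
  shows "mutual_info S T J = 0 \<longleftrightarrow> J = distr J S fst \<Otimes>\<^sub>M distr J T snd"
  unfolding mutual_info_def using assms prob_space_distr_fst[OF assms] prob_space_distr_snd[OF assms]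
  by (intro KL_eq_0_iff prob_space_pair) (auto intro!: sets_pair_measure_cong)

lemma emeasure_distr_fst:
  assumes "sets J = sets (S \<Otimes>\<^sub>M T)" "A \<in> sets S"
  shows "emeasure (distr J S fst) A = emeasure J (A \<times> space T)"
proof -
  have "fst -` A \<inter> space J = A \<times> space T"
    using sets_eq_imp_space_eq[OF assms(1)] sets.sets_into_space[OF assms(2)]
    by (auto simp: space_pair_measure)
  then show ?thesis
    using assms by (subst emeasure_distr) (simp_all cong: measurable_cong_sets)
qed

lemma emeasure_distr_snd:
  assumes "sets J = sets (S \<Otimes>\<^sub>M T)" "B \<in> sets T"
  shows "emeasure (distr J T snd) B = emeasure J (space S \<times> B)"
proof -
  have "snd -` B \<inter> space J = space S \<times> B"
    using sets_eq_imp_space_eq[OF assms(1)] sets.sets_into_space[OF assms(2)]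
    by (auto simp: space_pair_measure)
  then show ?thesis
    using assms by (subst emeasure_distr) (simp_all cong: measurable_cong_sets)
qed

text \<open>Rectangles form an intersection-stable generator of the product sigma-algebra, and the
  marginals are finite, so agreement on rectangles gives agreement of the measures. Marginal masses
  are written as masses of strips under \<open>J\<close>, so that a formula for \<open>J\<close> on
  rectangles suffices to test independence.\<close>

lemma mutual_info_eq_0_iff_rectangles:
  assumes J: "prob_space J" "sets J = sets (S \<Otimes>\<^sub>M T)"
  shows "mutual_info S T J = 0 \<longleftrightarrow>
    (\<forall>A\<in>sets S. \<forall>B\<in>sets T. emeasure J (A \<times> B) = emeasure J (A \<times> space T) * emeasure J (space S \<times> B))"
    (is "_ \<longleftrightarrow> ?R")
proof -
  interpret S: prob_space "distr J S fst" using J by (rule prob_space_distr_fst)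
  interpret T: prob_space "distr J T snd" using J by (rule prob_space_distr_snd)
  have "J = distr J S fst \<Otimes>\<^sub>M distr J T snd \<longleftrightarrow> ?R"
  proof
    assume eq: "J = distr J S fst \<Otimes>\<^sub>M distr J T snd"
    show ?R
    proof (intro ballI)
      fix A B assume AB: "A \<in> sets S" "B \<in> sets T"
      then have "emeasure (distr J S fst \<Otimes>\<^sub>M distr J T snd) (A \<times> B)
          = emeasure (distr J S fst) A * emeasure (distr J T snd) B"
        by (intro T.emeasure_pair_measure_Times) auto
      then show "emeasure J (A \<times> B) = emeasure J (A \<times> space T) * emeasure J (space S \<times> B)"
        unfolding eq[symmetric] using J(2) AB by (simp add: emeasure_distr_fst emeasure_distr_snd)
    qed
  next
    assume R: ?R
    have "distr J S fst \<Otimes>\<^sub>M distr J T snd = J"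
    proof (rule pair_measure_eqI)
      fix A B assume "A \<in> sets (distr J S fst)" "B \<in> sets (distr J T snd)"
      then have AB: "A \<in> sets S" "B \<in> sets T" by simp_all
      show "emeasure (distr J S fst) A * emeasure (distr J T snd) B = emeasure J (A \<times> B)"
        unfolding emeasure_distr_fst[OF J(2) AB(1)] emeasure_distr_snd[OF J(2) AB(2)]
        by (rule R[rule_format, OF AB, symmetric])
    next
      show "sets (distr J S fst \<Otimes>\<^sub>M distr J T snd) = sets J"
        using J(2) by (auto intro!: sets_pair_measure_cong)
    qed unfold_locales
    then show "J = distr J S fst \<Otimes>\<^sub>M distr J T snd" ..
  qed
  then show ?thesis
    using J by (simp add: mutual_info_eq_0_iff)
qed

text \<open>The discarded factor has mass 1. The target \<open>M'\<close> need only share the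
  sigma-algebra of \<open>M\<close>: \<open>semantic\<close> and \<open>style\<close> push forward
  to \<open>C\<close> and \<open>borel\<close>, not to the factors themselves.\<close>

lemma distr_pair_measure_fst:
  assumes "prob_space M" "prob_space N" "sets M = sets M'"
  shows "distr (M \<Otimes>\<^sub>M N) M' fst = M"
proof -
  interpret N: prob_space N by fact
  have "distr (M \<Otimes>\<^sub>M N) M' fst = distr (M \<Otimes>\<^sub>M N) M fst"
    using assms by (intro distr_cong) auto
  then show ?thesis
    by (simp add: N.distr_pair_fst)
qed

lemma distr_pair_measure_snd:
  assumes "prob_space M" "prob_space N" "sets N = sets N'"
  shows "distr (M \<Otimes>\<^sub>M N) N' snd = N"
proof (rule measure_eqI)
  interpret M: prob_space M by fact
  interpret N: prob_space N by fact
  fix A assume "A \<in> sets (distr (M \<Otimes>\<^sub>M N) N' snd)"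
  then have A: "A \<in> sets N" using assms by simp
  have "emeasure (distr (M \<Otimes>\<^sub>M N) N' snd) A = emeasure (M \<Otimes>\<^sub>M N) (space M \<times> A)"
    using assms A by (intro emeasure_distr_snd) (auto intro: sets_pair_measure_cong)
  also have "\<dots> = emeasure N A"
    using A by (simp add: N.emeasure_pair_measure_Times M.emeasure_space_1)
  finally show "emeasure (distr (M \<Otimes>\<^sub>M N) N' snd) A = emeasure N A" .
qed (simp add: assms)

section \<open>The Gaussian prior and the uniform label\<close>

lemma sets_std_gaussian [simp]: "sets std_gaussian = sets borel"
  by (simp add: std_gaussian_def)

text \<open>A law with a Lebesgue density has no atoms. This separates the Gaussian from the point
  mass in the counterexample.\<close>

lemma emeasure_std_gaussian_singleton:
  fixes x :: "real ^ 'd"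
  shows "emeasure std_gaussian {x} = 0"
proof -
  have "absolutely_continuous lborel (std_gaussian :: (real ^ 'd) measure)"
    unfolding std_gaussian_def by (intro absolutely_continuousI_density) measurable
  moreover have "{x} \<in> null_sets lborel"
    by (simp add: null_sets_def)
  ultimately have "{x} \<in> null_sets std_gaussian"
    unfolding absolutely_continuous_def by (rule subsetD)
  then show ?thesis
    by (rule null_setsD1)
qed

text \<open>Each label carries the positive mass \<open>1 / K\<close>, so no label can be neglected;
  for \<open>K = 0\<close> both sides are vacuous.\<close>

lemma AE_label_law_iff: "(AE k in label_law K. P k) \<longleftrightarrow> (\<forall>k\<in>{1..K}. P k)"
proof -
  have "K \<noteq> 0" if "k \<in> {1..K}" for k
    using that by auto
  then show ?thesis
    unfolding label_law_def uniform_count_measure_def AE_point_measure by auto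
qed

text \<open>The expectation is a finite sum of nonnegative terms over \<open>K\<close>, so nothing
  can cancel.\<close>

lemma expectation_label_law_eq_0_iff: "(\<integral>\<^sup>+k. f k \<partial>label_law K) = 0 \<longleftrightarrow> (\<forall>k\<in>{1..K}. f k = 0)"
  by (simp add: expectation_label_law)

lemma space_label_law [simp]: "space (label_law K) = {1..K}"
  by (simp add: label_law_def space_uniform_count_measure)

lemma sets_label_law [simp]: "sets (label_law K) = Pow {1..K}"
  by (simp add: label_law_def sets_uniform_count_measure)

section \<open>Class-conditional families and the joint law of style and label\<close>

locale class_conditional =
  fixes K :: nat
    and C :: "'c measure"
    and q :: "nat \<Rightarrow> ('c \<times> (real ^ 'd)) measure"
  assumes K: "1 \<le> K"
    and q: "q \<in> {1..K} \<rightarrow> space (prob_algebra (C \<Otimes>\<^sub>M borel))"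
begin

lemma prob_space_q: "k \<in> {1..K} \<Longrightarrow> prob_space (q k)"
  and sets_q: "k \<in> {1..K} \<Longrightarrow> sets (q k) = sets (C \<Otimes>\<^sub>M borel)"
  using q by (auto simp: space_prob_algebra)

lemma prob_space_style: "k \<in> {1..K} \<Longrightarrow> prob_space (style q k)"
  unfolding style_def by (rule prob_space_distr_snd[OF prob_space_q sets_q])

lemma prob_space_semantic: "k \<in> {1..K} \<Longrightarrow> prob_space (semantic C q k)"
  unfolding semantic_def by (rule prob_space_distr_fst[OF prob_space_q sets_q])

text \<open>The label space is discrete, so measurability is automatic and only the total mass of
  each value has to be checked.\<close>

lemma label_kernel:
  "(\<lambda>k. distr (style q k) (borel \<Otimes>\<^sub>M count_space {1..K}) (\<lambda>s. (s, k)))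
    \<in> label_law K \<rightarrow>\<^sub>M prob_algebra (borel \<Otimes>\<^sub>M count_space {1..K})"
proof -
  have "prob_space (distr (style q k) (borel \<Otimes>\<^sub>M count_space {1..K}) (\<lambda>s. (s, k)))"
    if "k \<in> {1..K}" for k
    using that by (intro prob_space.prob_space_distr prob_space_style) (simp_all add: style_def)
  then show ?thesis
    by (auto simp: measurable_def space_prob_algebra)
qed

lemma label_law_in_prob_algebra: "label_law K \<in> space (prob_algebra (label_law K))"
  using K by (auto simp: space_prob_algebra label_law_def intro: prob_space_uniform_count_measure)

lemma style_label_law_in_prob_algebra:
  "style_label_law K q \<in> space (prob_algebra (borel \<Otimes>\<^sub>M count_space {1..K}))"
proof -
  interpret prob_space "label_law K"
    using label_law_in_prob_algebra by (simp add: space_prob_algebra)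
  note kernel = measurable_prob_algebraD[OF label_kernel]
  have "prob_space (style_label_law K q)"
    unfolding style_label_law_def
    using label_kernel by (intro prob_space_bind[OF _ kernel] AE_I2)
      (auto dest: measurable_space simp: space_prob_algebra)
  moreover have "sets (style_label_law K q) = sets (borel \<Otimes>\<^sub>M count_space {1..K})"
    unfolding style_label_law_def using K by (intro sets_bind sets_kernel[OF kernel]) auto
  ultimately show ?thesis
    by (simp add: space_prob_algebra del: One_nat_def)
qed

lemma of_nat_K_divide_self [simp]: "of_nat K / of_nat K = (1 :: ennreal)"
  using K by (intro ennreal_divide_self) (auto simp: of_nat_less_top)

lemma sum_indicator_labels:
  assumes "B \<subseteq> {1..K}"
  shows "(\<Sum>k=1..K. indicator B k) = (of_nat (card B) :: ennreal)"
proof -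
  have "(\<Sum>k=1..K. indicator B k) = (\<Sum>k\<in>{1..K} \<inter> B. 1 :: ennreal)"
    by (simp add: sum.inter_restrict indicator_def of_bool_def del: sum_constant)
  then show ?thesis
    using assms by (simp add: Int_absorb1 del: One_nat_def)
qed

text \<open>Given the label \<open>k\<close>, the pair \<open>(s, k)\<close> lies in the rectangle
  exactly when \<open>s\<close> is in \<open>A\<close> and \<open>k\<close> is in \<open>B\<close>.
  Averaging over the labels gives the formula.\<close>

lemma emeasure_style_label_law:
  assumes A: "A \<in> sets borel" and B: "B \<subseteq> {1..K}"
  shows "emeasure (style_label_law K q) (A \<times> B)
    = (\<Sum>k=1..K. emeasure (style q k) A * indicator B k) / of_nat K"
proof -
  have AB: "A \<times> B \<in> sets (borel \<Otimes>\<^sub>M count_space {1..K})"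
    using A B by auto
  have "emeasure (distr (style q k) (borel \<Otimes>\<^sub>M count_space {1..K}) (\<lambda>s. (s, k))) (A \<times> B)
      = emeasure (style q k) A * indicator B k" if "k \<in> {1..K}" for k
  proof -
    have "(\<lambda>s. (s, k)) -` (A \<times> B) \<inter> space (style q k) = (if k \<in> B then A else {})"
      by (auto simp: style_def)
    with that show ?thesis
      by (subst emeasure_distr[OF _ AB]) (simp_all add: style_def)
  qed
  then show ?thesis
    using K unfolding style_label_law_def
    by (simp add: emeasure_bind[OF _ measurable_prob_algebraD[OF label_kernel] AB]
      expectation_label_law del: One_nat_def)
qed

lemma emeasure_style_label_law_marginals:
  shows "A \<in> sets borel \<Longrightarrow> emeasure (style_label_law K q) (A \<times> {1..K}) = emeasure (agg_style K q) A"
    and "B \<subseteq> {1..K} \<Longrightarrow> emeasure (style_label_law K q) (UNIV \<times> B) = of_nat (card B) / of_nat K"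
proof -
  assume "A \<in> sets borel"
  then show "emeasure (style_label_law K q) (A \<times> {1..K}) = emeasure (agg_style K q) A"
    using K by (simp add: emeasure_style_label_law emeasure_agg_style[OF K q])
next
  assume B: "B \<subseteq> {1..K}"
  have "emeasure (style q k) UNIV = 1" if "k \<in> {1..K}" for k
    using prob_space.emeasure_space_1[OF prob_space_style[OF that]] by (simp add: style_def)
  then have "(\<Sum>k=1..K. emeasure (style q k) UNIV * indicator B k) = (\<Sum>k=1..K. indicator B k)"
    by (intro sum.cong) auto
  also have "\<dots> = of_nat (card B)"
    using B by (rule sum_indicator_labels)
  finally show "emeasure (style_label_law K q) (UNIV \<times> B) = of_nat (card B) / of_nat K"
    using B by (simp add: emeasure_style_label_law)
qed

section \<open>When each of the quantities vanishes\<close>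

lemma style_label_info_eq_0_iff_rectangles:
  "style_label_info K q = 0 \<longleftrightarrow> (\<forall>A\<in>sets borel. \<forall>B\<in>Pow {1..K}.
    emeasure (style_label_law K q) (A \<times> B) = emeasure (agg_style K q) A * (of_nat (card B) / of_nat K))"
proof -
  have J: "prob_space (style_label_law K q)"
    "sets (style_label_law K q) = sets (borel \<Otimes>\<^sub>M count_space {1..K})"
    using style_label_law_in_prob_algebra by (simp_all add: space_prob_algebra del: One_nat_def)
  show ?thesis
    unfolding style_label_info_def mutual_info_eq_0_iff_rectangles[OF J]
    by (simp add: emeasure_style_label_law_marginals del: One_nat_def cong: ball_cong_simp)
qed

lemma sets_agg_style: "sets (agg_style K q) = sets borel"
  unfolding agg_style_def using K by (intro sets_bind) (auto simp: style_def)

lemma agg_style_const: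
  assumes "\<And>k. k \<in> {1..K} \<Longrightarrow> style q k = N"
  shows "agg_style K q = N"
proof (rule measure_eqI)
  show "sets (agg_style K q) = sets N"
    using assms[of 1] K by (auto simp: sets_agg_style style_def)
  fix A assume "A \<in> sets (agg_style K q)"
  then show "emeasure (agg_style K q) A = emeasure N A"
    \<comment> \<open>The sum of \<open>K\<close> equal terms is regrouped so that
      \<open>of_nat K / of_nat K\<close> appears and reduces to 1.\<close>
    using K by (simp add: sets_agg_style emeasure_agg_style[OF K q] assms
      mult.commute[of "of_nat K"] flip: ennreal_times_divide)
qed

lemma prob_space_agg_style: "prob_space (agg_style K q)"
proof
  \<comment> \<open>The mass of the whole space under the joint law is read in two ways: as the
    total mass of the style marginal, and as \<open>K / K\<close> for the label marginal.\<close>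
  have "emeasure (agg_style K q) UNIV = 1"
    using emeasure_style_label_law_marginals(1)[of UNIV]
      emeasure_style_label_law_marginals(2)[of "{1..K}"] K
    by simp
  then show "emeasure (agg_style K q) (space (agg_style K q)) = 1"
    using sets_eq_imp_space_eq[OF sets_agg_style] by simp
qed

text \<open>Independence of style and label is tested on rectangles. Those of the form
  \<open>A \<times> {k}\<close> isolate a single class, which gives one direction; conversely, a
  style law common to all classes factors out of every rectangle.\<close>

lemma style_label_info_eq_0_iff:
  "style_label_info K q = 0 \<longleftrightarrow> (\<forall>k\<in>{1..K}. style q k = agg_style K q)"
proof
  assume 0: "style_label_info K q = 0"
  show "\<forall>k\<in>{1..K}. style q k = agg_style K q"
  proof (intro ballI measure_eqI)
    fix k A assume k: "k \<in> {1..K}" and "A \<in> sets (style q k)"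
    then have A: "A \<in> sets borel" by (simp add: style_def)
    have "(\<Sum>j=1..K. emeasure (style q j) A * indicator {k} j)
        = (\<Sum>j=1..K. if j = k then emeasure (style q j) A else 0)"
      by (intro sum.cong) auto
    also have "\<dots> = emeasure (style q k) A"
      using k by simp
    finally have "emeasure (style q k) A / of_nat K = emeasure (agg_style K q) A / of_nat K"
      using 0 A k emeasure_style_label_law[of A "{k}"]
      by (simp add: style_label_info_eq_0_iff_rectangles ennreal_times_divide)
    \<comment> \<open>Both sides carry the label probability \<open>1 / K\<close>; it cancels
      because \<open>K\<close> is finite and nonzero.\<close>
    then have "emeasure (style q k) A / of_nat K * of_nat K
        = emeasure (agg_style K q) A / of_nat K * of_nat K"
      by simp
    then show "emeasure (style q k) A = emeasure (agg_style K q) A"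
      using K by (simp add: ennreal_divide_times)
  qed (simp add: sets_agg_style style_def)
next
  assume eq: "\<forall>k\<in>{1..K}. style q k = agg_style K q"
  \<comment> \<open>With the common style mass taken out of the sum, the indicators only count the
    labels in \<open>B\<close>.\<close>
  have "(\<Sum>k=1..K. emeasure (style q k) A * indicator B k)
      = emeasure (agg_style K q) A * of_nat (card B)" if "B \<subseteq> {1..K}" for A B
  proof -
    have "(\<Sum>k=1..K. emeasure (style q k) A * indicator B k)
        = emeasure (agg_style K q) A * (\<Sum>k=1..K. indicator B k)"
      using eq by (simp add: sum_distrib_left)
    then show ?thesis
      using sum_indicator_labels[OF that] by simp
  qed
  then show "style_label_info K q = 0"
    by (auto simp: style_label_info_eq_0_iff_rectangles emeasure_style_label_law
      ennreal_times_divide)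
qed

lemma cond_info_eq_0_iff:
  "cond_info K C q = 0 \<longleftrightarrow> (\<forall>k\<in>{1..K}. q k = semantic C q k \<Otimes>\<^sub>M style q k)"
  by (simp add: cond_info_def expectation_label_law_eq_0_iff mutual_info_eq_0_iff
    prob_space_q sets_q semantic_def style_def)

lemma KL_agg_style_eq_0_iff: "KL (agg_style K q) std_gaussian = 0 \<longleftrightarrow> agg_style K q = std_gaussian"
  using prob_space_agg_style prob_space_std_gaussian sets_agg_style by (intro KL_eq_0_iff) auto

lemma expected_KL_semantic_eq_0_iff:
  assumes "p \<in> {1..K} \<rightarrow> space (prob_algebra C)"
  shows "(\<integral>\<^sup>+k. KL (semantic C q k) (p k) \<partial>label_law K) = 0 \<longleftrightarrow> (\<forall>k\<in>{1..K}. semantic C q k = p k)"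
proof -
  have "KL (semantic C q k) (p k) = 0 \<longleftrightarrow> semantic C q k = p k" if "k \<in> {1..K}" for k
    using assms that prob_space_semantic[OF that]
    by (intro KL_eq_0_iff) (auto simp: space_prob_algebra semantic_def)
  then show ?thesis
    by (simp add: expectation_label_law_eq_0_iff)
qed

lemma M_fact_eq_0_iff:
  assumes "p \<in> {1..K} \<rightarrow> space (prob_algebra C)"
  shows "M_fact K q p = 0 \<longleftrightarrow> (\<forall>k\<in>{1..K}. q k = p k \<Otimes>\<^sub>M std_gaussian)"
proof -
  have "KL (q k) (p k \<Otimes>\<^sub>M std_gaussian) = 0 \<longleftrightarrow> q k = p k \<Otimes>\<^sub>M std_gaussian" if "k \<in> {1..K}" for k
    using assms that prob_space_q[OF that] sets_q[OF that]
    by (intro KL_eq_0_iff prob_space_pair prob_space_std_gaussian)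
      (auto simp: space_prob_algebra intro!: sets_pair_measure_cong)
  then show ?thesis
    by (simp add: M_fact_def expectation_label_law_eq_0_iff)
qed

text \<open>The common law \<open>N\<close> is arbitrary, which is the source of the failure of
  sufficiency: invariance across classes says nothing about the Gaussian.\<close>

lemma style_label_info_eq_0I:
  assumes "\<And>k. k \<in> {1..K} \<Longrightarrow> style q k = N"
  shows "style_label_info K q = 0"
  using assms agg_style_const[OF assms] by (simp add: style_label_info_eq_0_iff)

end

section \<open>The equivalences and the counterexample\<close>

theorem corollary1:
  fixes K :: nat
    and C :: "'c measure"
    and q :: "nat \<Rightarrow> ('c \<times> (real ^ 'd)) measure"
    and p :: "nat \<Rightarrow> 'c measure"
  assumes "1 \<le> K"
    and "q \<in> {1..K} \<rightarrow> space (prob_algebra (C \<Otimes>\<^sub>M borel))"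
    and "p \<in> {1..K} \<rightarrow> space (prob_algebra C)"
  shows
    "((AE k in label_law K. q k = p k \<Otimes>\<^sub>M std_gaussian) \<longleftrightarrow> M_fact K q p = 0)
   \<and> (M_fact K q p = 0 \<longleftrightarrow>
        KL (agg_style K q) std_gaussian = 0
      \<and> style_label_info K q = 0
      \<and> (\<integral>\<^sup>+k. KL (semantic C q k) (p k) \<partial>label_law K) = 0
      \<and> cond_info K C q = 0)
   \<and> ((AE k in label_law K. q k = p k \<Otimes>\<^sub>M std_gaussian) \<longrightarrow> style_label_info K q = 0)
   \<and> (\<exists>(q' :: nat \<Rightarrow> ('c \<times> (real ^ 'd)) measure) p'.
        q' \<in> {1..K} \<rightarrow> space (prob_algebra (C \<Otimes>\<^sub>M borel))
      \<and> p' \<in> {1..K} \<rightarrow> space (prob_algebra C)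
      \<and> style_label_info K q' = 0
      \<and> \<not> (AE k in label_law K. q' k = p' k \<Otimes>\<^sub>M std_gaussian))"
proof -
  interpret class_conditional K C q
    using assms(1,2) by unfold_locales
  have p: "prob_space (p k)" "sets (p k) = sets C" if "k \<in> {1..K}" for k
    using assms(3) that by (auto simp: space_prob_algebra)
  let ?fact = "\<forall>k\<in>{1..K}. q k = p k \<Otimes>\<^sub>M std_gaussian"
  have marginals: "semantic C q k = p k" "style q k = std_gaussian" if ?fact "k \<in> {1..K}" for k
    using that p[OF that(2)]
    by (simp_all add: prob_space_std_gaussian semantic_def style_def distr_pair_measure_fst distr_pair_measure_snd)
  have four: "?fact \<longleftrightarrow> agg_style K q = std_gaussian \<and> (\<forall>k\<in>{1..K}. style q k = agg_style K q)
      \<and> (\<forall>k\<in>{1..K}. semantic C q k = p k) \<and> (\<forall>k\<in>{1..K}. q k = semantic C q k \<Otimes>\<^sub>M style q k)"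
    (is "_ \<longleftrightarrow> ?four")
  proof
    assume f: ?fact
    moreover from f have "agg_style K q = std_gaussian"
      by (intro agg_style_const marginals)
    ultimately show ?four
      using marginals[OF f] by simp
  \<comment> \<open>The converse is substitution: in
    \<open>semantic C q k \<Otimes>\<^sub>M style q k\<close> the first factor becomes
    \<open>p k\<close> and the second becomes \<open>agg_style K q\<close>, hence the
    Gaussian.\<close>
  qed simp
  have witness: "\<exists>(q' :: nat \<Rightarrow> ('c \<times> (real ^ 'd)) measure) p'.
        q' \<in> {1..K} \<rightarrow> space (prob_algebra (C \<Otimes>\<^sub>M borel))
      \<and> p' \<in> {1..K} \<rightarrow> space (prob_algebra C)
      \<and> style_label_info K q' = 0
      \<and> \<not> (AE k in label_law K. q' k = p' k \<Otimes>\<^sub>M std_gaussian)"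
  proof -
    \<comment> \<open>Only the style prior is spoiled: \<open>q'\<close> keeps the semantic marginal
      \<open>p k\<close> and within-class independence, and the semantic prior stays
      \<open>p\<close>. Thus (1) is the only one of the four quantities that does not
      vanish.\<close>
    define N :: "(real ^ 'd) measure" where "N = return borel 0"
    define q' where "q' = (\<lambda>k. p k \<Otimes>\<^sub>M N)"
    have N: "prob_space N" "sets N = sets borel"
      by (auto simp: N_def intro: prob_space_return)
    have q': "q' \<in> {1..K} \<rightarrow> space (prob_algebra (C \<Otimes>\<^sub>M borel))"
      using p N by (auto simp: q'_def space_prob_algebra intro!: prob_space_pair sets_pair_measure_cong)
    interpret q': class_conditional K C q'
      using assms(1) q' by unfold_locales
    have style': "style q' k = N" if "k \<in> {1..K}" for k
      using p[OF that] N by (simp add: style_def q'_def distr_pair_measure_snd)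
    then have "style_label_info K q' = 0"
      by (rule q'.style_label_info_eq_0I)
    \<comment> \<open>One failing class is enough, since a.e. means every label; label 1 exists
      because \<open>1 \<le> K\<close>.\<close>
    moreover have "q' 1 \<noteq> p 1 \<Otimes>\<^sub>M std_gaussian"
    proof
      assume "q' 1 = p 1 \<Otimes>\<^sub>M std_gaussian"
      \<comment> \<open>Projecting both products to the style coordinate recovers their second
        factors, which differ in the mass of the origin.\<close>
      then have "N = std_gaussian"
        using style'[of 1] p[of 1] assms(1)
        by (simp add: prob_space_std_gaussian style_def distr_pair_measure_snd)
      moreover have "emeasure N {0} = 1"
        by (simp add: N_def)
      ultimately show False
        by (simp add: emeasure_std_gaussian_singleton)
    qed
    ultimately show ?thesis
      using q' assms(1,3) by (intro exI[of _ q'] exI[of _ p]) (auto simp: AE_label_law_iff)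
  qed
  have invariant: "?fact \<longrightarrow> (\<forall>k\<in>{1..K}. style q k = agg_style K q)"
    by (intro impI) (rule iffD1[OF four, THEN conjunct2, THEN conjunct1])
  show ?thesis
    \<comment> \<open>After rewriting, the a.e. equality and \<open>M_fact K q p = 0\<close> are
      both literally \<open>?fact\<close>, so the first equivalence is reflexive and the second is
      \<open>four\<close>.\<close>
    unfolding AE_label_law_iff M_fact_eq_0_iff[OF assms(3)] KL_agg_style_eq_0_iff
      style_label_info_eq_0_iff expected_KL_semantic_eq_0_iff[OF assms(3)] cond_info_eq_0_iff
    by (intro conjI refl four invariant witness[unfolded AE_label_law_iff])
qed

end
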